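(* Let $n\ge2$, $1\le p<n$, $\frac1p-\frac1{p^*}=\frac1n$, and $\beta\in\mathbb{R}$. Suppose that there is a constant $C$ such that for every weight $w\in A_1$ on $\mathbb{R}^n$, every Lipschitz function $f$ and every cube $Q$ $$\left(\frac{1}{w(Q)}\int_Q|f-f_{Q,w}|^{p^*}\,w\,dx\right)^{1/p^*}\le C\,[w]_{A_1}^\beta\,\ell(Q)\left(\frac{1}{w(Q)}\int_Q|\nabla f|^p\,w\,dx\right)^{1/p}.$$ Then $\beta\ge\frac1p$.
   Context: Cubes are cubes in $\mathbb{R}^n$ with sides parallel to the coordinate axes, with side length $\ell(Q)$. A weight is a locally integrable non-negative function; $w(Q)=\int_Q w\,dx$; $f_{Q,w}=\frac{1}{w(Q)}\int_Q f\,w\,dx$. A weight $w$ is in $A_1$ if $$[w]_{A_1}:=\sup_Q\left(\frac{1}{|Q|}\int_Q w\,dx\right)\operatorname*{ess\,sup}_Q(w^{-1})<\infty.$$ *)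

theory Defs
  imports "HOL-Analysis.Analysis" "HOL-Probability.Essential_Supremum"
begin

text \<open>A cube with sides parallel to the axes is given by its lowest corner \<open>a\<close> and its side
  length \<open>l\<close>, with \<open>0 < l\<close> required at each use. Whether cubes are open or closed
  is immaterial, since their faces are null sets.\<close>

definition cube :: "real ^ 'n \<Rightarrow> real \<Rightarrow> (real ^ 'n) set" where
  "cube a l = cbox a (a + vec l)"

definition weight :: "(real ^ 'n \<Rightarrow> real) \<Rightarrow> bool" where
  "weight w \<longleftrightarrow>
    (\<forall>x. 0 \<le> w x) \<and> (\<forall>K. compact K \<longrightarrow> w absolutely_integrable_on K)"

definition wmass :: "(real ^ 'n \<Rightarrow> real) \<Rightarrow> (real ^ 'n) set \<Rightarrow> real" where
  "wmass w Q = (LINT x:Q|lebesgue. w x)"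

definition wavg :: "(real ^ 'n \<Rightarrow> real) \<Rightarrow> (real ^ 'n) set \<Rightarrow> (real ^ 'n \<Rightarrow> real) \<Rightarrow> real" where
  "wavg w Q f = 1 / wmass w Q * (LINT x:Q|lebesgue. f x * w x)"

text \<open>The \<open>A\<^sub>1\<close> constant is computed in \<^typ>\<open>ennreal\<close>, so that the reciprocal of \<open>w\<close> is
  \<open>\<infinity>\<close> (and not \<open>0\<close>) where \<open>w\<close> vanishes. As \<open>0 * \<infinity> = 0\<close> there, a weight that is zero
  almost everywhere has constant \<open>0\<close>; every other weight with finite constant has positive mass
  on every cube, and constant at least \<open>1\<close>.\<close>

definition A1_const :: "(real ^ 'n \<Rightarrow> real) \<Rightarrow> ennreal" where
  "A1_const w =
    (SUP (a, l) \<in> {(a, l). 0 < l}.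
      ((\<integral>\<^sup>+x\<in>cube a l. ennreal (w x) \<partial>lebesgue) / emeasure lebesgue (cube a l)) *
      esssup (lebesgue_on (cube a l)) (\<lambda>x. inverse (ennreal (w x))))"

definition A1 :: "(real ^ 'n \<Rightarrow> real) \<Rightarrow> bool" where
  "A1 w \<longleftrightarrow> weight w \<and> A1_const w < \<infinity>"

text \<open>The gradient is unspecified where \<open>f\<close> is not differentiable. For Lipschitz \<open>f\<close> this is a
  null set by Rademacher's theorem, hence irrelevant for integrals with respect to the complete
  measure \<^term>\<open>lebesgue\<close>.\<close>

definition gradient :: "(real ^ 'n \<Rightarrow> real) \<Rightarrow> real ^ 'n \<Rightarrow> real ^ 'n" where
  "gradient f x = (THE D. GDERIV f x :> D)"

end

theory Submission
  imports Defs
begin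

text \<open>
  The test weight is \<open>w x = 1 + s (x\<^sub>i) + s (1 - x\<^sub>i)\<close> for one fixed coordinate \<open>i\<close>, where
  \<open>s t = 1 / (e + \<bar>t\<bar>)\<close> on \<open>[-1, 1]\<close> and \<open>s t = 0\<close> elsewhere. With
  \<open>\<Lambda> = ln ((e + 1) / e)\<close>, its \<open>A\<^sub>1\<close> constant and its mass on the unit cube
  \<open>Q\<close> are both comparable to \<open>\<Lambda>\<close>, and the mass is shared between the two opposite faces
  \<open>x\<^sub>i = 0\<close> and \<open>x\<^sub>i = 1\<close>. The function
  \<open>f x = cos (\<pi> x\<^sub>i)\<close> separates these faces, so its oscillation on \<open>Q\<close> stays bounded below,
  whereas its gradient vanishes on them and cancels the peaks of \<open>w\<close>: the integral of
  \<open>\<bar>\<nabla>f\<bar>\<^sup>p w\<close> over \<open>Q\<close> stays bounded. The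
  hypothesis then gives \<open>1 \<lesssim> \<Lambda> powr (max \<beta> 0 - 1 / p)\<close>, and \<open>\<Lambda> \<rightarrow> \<infinity>\<close> as \<open>e \<rightarrow> 0\<close>.
\<close>

section \<open>Integrals over cubes of functions of one coordinate\<close>

text \<open>Tonelli: the indicator of a cube is a product of interval indicators over
  \<open>Basis\<close>. The function \<open>h\<close> is put into the factor of direction
  \<open>axis i 1\<close>, and every other factor integrates to \<open>l\<close>.\<close>

lemma nn_integral_cube:
  fixes h :: "real \<Rightarrow> ennreal" and a :: "real ^ 'n" and i :: "'n::finite"
  assumes [measurable]: "h \<in> borel_measurable borel" and "0 < l"
  shows "(\<integral>\<^sup>+x\<in>cube a l. h (x $ i) \<partial>lebesgue) =
    ennreal l ^ (CARD('n) - 1) * (\<integral>\<^sup>+t\<in>{a $ i..a $ i + l}. h t \<partial>lborel)"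
proof -
  define F :: "real ^ 'n \<Rightarrow> real \<Rightarrow> ennreal" where
    "F b t = (if b = axis i 1 then h t else 1) * indicator {a \<bullet> b..a \<bullet> b + l} t" for b t
  have bas: "axis i (1::real) \<in> Basis"
    by (simp add: axis_in_Basis_iff)
  have vecB: "vec l \<bullet> b = l" if "b \<in> Basis" for b :: "real ^ 'n"
    using that by (auto simp: Basis_vec_def inner_axis)
  have ind: "indicator (cube a l) x = (\<Prod>b\<in>Basis. indicator {a \<bullet> b..a \<bullet> b + l} (x \<bullet> b) :: ennreal)" for x
  proof (cases "x \<in> cube a l")
    case True
    then show ?thesis by (simp add: cube_def mem_box vecB inner_add_left)
  next
    case False
    then obtain b where "b \<in> Basis" "x \<bullet> b \<notin> {a \<bullet> b..a \<bullet> b + l}"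
      by (auto simp: cube_def mem_box vecB inner_add_left)
    then show ?thesis using False by (auto simp: prod_zero_iff intro!: bexI[of _ b])
  qed
  have hF: "h (x $ i) = (\<Prod>b\<in>Basis. if b = axis i 1 then h (x \<bullet> b) else 1)" for x
    using bas by (simp add: prod.delta inner_axis)
  have "(\<integral>\<^sup>+x\<in>cube a l. h (x $ i) \<partial>lebesgue) = (\<integral>\<^sup>+x. (\<Prod>b\<in>Basis. F b (x \<bullet> b)) \<partial>lborel)"
    unfolding nn_integral_completion ind hF F_def prod.distrib[symmetric]
    by (intro nn_integral_cong prod.cong) auto
  also have "\<dots> = (\<Prod>b\<in>Basis. (\<integral>\<^sup>+t. F b t \<partial>lborel))"
    by (intro nn_integral_lborel_prod) (auto simp: F_def)
  also have "\<dots> = (\<integral>\<^sup>+t. F (axis i 1) t \<partial>lborel) * (\<Prod>b\<in>Basis - {axis i 1}. (\<integral>\<^sup>+t. F b t \<partial>lborel))"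
    by (rule prod.remove) (use bas in auto)
  also have "(\<Prod>b\<in>Basis - {axis i 1}. (\<integral>\<^sup>+t. F b t \<partial>lborel)) = (\<Prod>b\<in>(Basis - {axis i 1} :: (real ^ 'n) set). ennreal l)"
    using \<open>0 < l\<close> by (intro prod.cong) (auto simp: F_def)
  also have "\<dots> = ennreal l ^ (CARD('n) - 1)"
    using bas by (simp add: card_Diff_singleton)
  finally show ?thesis
    by (simp add: F_def inner_axis mult.commute)
qed

lemma emeasure_cube:
  fixes a :: "real ^ 'n::finite"
  assumes "0 < l"
  shows "emeasure lebesgue (cube a l) = ennreal l ^ CARD('n)"
  using nn_integral_cube[where h = "\<lambda>_. 1" and a = a and l = l] assms
  by (simp add: cube_def mult.commute flip: power_Suc)

text \<open>Carries the reduction to one variable over to real-valued integrals. If the integral is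
  infinite, both sides take the default value 0.\<close>

lemma set_lebesgue_integral_unit_cube:
  fixes h :: "real \<Rightarrow> real" and i :: "'n::finite"
  assumes [measurable]: "h \<in> borel_measurable borel" and nn: "\<And>t. 0 \<le> t \<Longrightarrow> t \<le> 1 \<Longrightarrow> 0 \<le> h t"
  shows "(LINT x:cube (0 :: real ^ 'n) 1|lebesgue. h (x $ i)) = enn2real (\<integral>\<^sup>+t\<in>{0..1}. ennreal (h t) \<partial>lborel)"
proof -
  let ?Q = "cube (0 :: real ^ 'n) 1"
  have Q: "?Q \<in> sets borel" by (simp add: cube_def)
  have mem: "0 \<le> x $ i" "x $ i \<le> 1" if "x \<in> ?Q" for x
    using that by (auto simp: cube_def mem_box_cart)
  have "(\<lambda>x. h (x $ i)) \<in> borel_measurable borel"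
    by (rule measurable_compose[OF _ assms(1)]) simp
  then have "(\<lambda>x. indicat_real ?Q x *\<^sub>R h (x $ i)) \<in> borel_measurable lebesgue"
    using Q by (intro measurable_completion) auto
  then have "(LINT x:?Q|lebesgue. h (x $ i)) = enn2real (\<integral>\<^sup>+x. ennreal (indicat_real ?Q x *\<^sub>R h (x $ i)) \<partial>lebesgue)"
    unfolding set_lebesgue_integral_def
    by (intro integral_eq_nn_integral) (auto simp: indicator_def nn mem)
  also have "(\<integral>\<^sup>+x. ennreal (indicat_real ?Q x *\<^sub>R h (x $ i)) \<partial>lebesgue) = (\<integral>\<^sup>+x\<in>?Q. ennreal (h (x $ i)) \<partial>lebesgue)"
    by (intro nn_integral_cong) (auto simp: indicator_def)
  also have "\<dots> = (\<integral>\<^sup>+t\<in>{0..1}. ennreal (h t) \<partial>lborel)"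
    by (subst nn_integral_cube) auto
  finally show ?thesis .
qed

section \<open>The one-dimensional profile of the weight\<close>

text \<open>The cut-off makes the integral over the whole line finite, so that one bound serves all
  intervals.\<close>

definition spike :: "real \<Rightarrow> real \<Rightarrow> real" where
  "spike e t = indicator {-1..1} t / (e + \<bar>t\<bar>)"

definition profile :: "real \<Rightarrow> real \<Rightarrow> real" where
  "profile e t = 1 + spike e t + spike e (1 - t)"

lemma borel_measurable_spike [measurable]: "spike e \<in> borel_measurable borel"
  unfolding spike_def by measurable

lemma borel_measurable_profile [measurable]: "profile e \<in> borel_measurable borel"
  unfolding profile_def by measurable

lemma spike_bounds:
  assumes "0 < e"
  shows "0 \<le> spike e t" "spike e t \<le> 1 / e"
  using assms by (auto simp: spike_def indicator_def frac_le)

lemma profile_bounds: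
  assumes "0 < e"
  shows "1 \<le> profile e t" "profile e t \<le> 1 + 2 / e"
  using spike_bounds[OF assms, of t] spike_bounds[OF assms, of "1 - t"] by (auto simp: profile_def)

lemma nn_integral_inverse_right:
  fixes c e d :: real
  assumes "0 < e" "0 \<le> d"
  shows "(\<integral>\<^sup>+t\<in>{c..c + d}. ennreal (1 / (e + (t - c))) \<partial>lborel) = ennreal (ln ((e + d) / e))"
proof -
  have "(\<integral>\<^sup>+t\<in>{c..c + d}. ennreal (1 / (e + (t - c))) \<partial>lborel) = ennreal (ln (e + (c + d - c)) - ln (e + (c - c)))"
    by (rule nn_integral_FTC_Icc) (use assms in \<open>auto intro!: derivative_eq_intros\<close>)
  then show ?thesis using assms by (simp add: ln_div)
qed

lemma nn_integral_inverse_left: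
  fixes c e d :: real
  assumes "0 < e" "0 \<le> d"
  shows "(\<integral>\<^sup>+t\<in>{c - d..c}. ennreal (1 / (e + (c - t))) \<partial>lborel) = ennreal (ln ((e + d) / e))"
proof -
  have "(\<integral>\<^sup>+t\<in>{c - d..c}. ennreal (1 / (e + (c - t))) \<partial>lborel) = ennreal (- ln (e + (c - c)) - (- ln (e + (c - (c - d)))))"
    by (rule nn_integral_FTC_Icc) (use assms in \<open>auto intro!: derivative_eq_intros\<close>)
  then show ?thesis using assms by (simp add: ln_div)
qed

lemma nn_integral_spike_le:
  assumes "0 < e"
  shows "(\<integral>\<^sup>+t. ennreal (spike e t) \<partial>lborel) \<le> ennreal (2 * ln ((e + 1) / e))"
proof -
  have "(\<integral>\<^sup>+t. ennreal (spike e t) \<partial>lborel) \<le>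
    (\<integral>\<^sup>+t. ennreal (1 / (e + (t - 0))) * indicator {0..0 + 1} t + ennreal (1 / (e + (0 - t))) * indicator {0 - 1..0} t \<partial>lborel)"
    by (intro nn_integral_mono) (auto simp: spike_def indicator_def)
  also have "\<dots> = ennreal (ln ((e + 1) / e)) + ennreal (ln ((e + 1) / e))"
    using assms by (subst nn_integral_add) (simp_all only: nn_integral_inverse_right nn_integral_inverse_left, auto)
  also have "\<dots> = ennreal (2 * ln ((e + 1) / e))"
    using assms by (subst ennreal_plus[symmetric]) (auto simp: field_simps)
  finally show ?thesis .
qed

lemma nn_integral_spike_reflect_le:
  assumes "0 < e"
  shows "(\<integral>\<^sup>+t. ennreal (spike e (1 - t)) \<partial>lborel) \<le> ennreal (2 * ln ((e + 1) / e))"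
proof -
  have "(\<integral>\<^sup>+t. ennreal (spike e t) \<partial>lborel) = (\<integral>\<^sup>+t. ennreal (spike e (1 - t)) \<partial>lborel)"
    by (subst nn_integral_real_affine[where c = "-1" and t = 1]) auto
  with nn_integral_spike_le[OF assms] show ?thesis by simp
qed

text \<open>A pointwise comparison whose error factor \<open>1 + l * spike e t\<close> has average
  at most \<open>1 + 2 * \<Lambda>\<close> over any interval of length \<open>l\<close>. It rests on
  \<open>e + \<bar>s\<bar> \<le> e + \<bar>t\<bar> + l\<close>, divided by
  \<open>e + \<bar>t\<bar>\<close>.\<close>

lemma spike_le_profile:
  assumes "0 < e" "\<bar>t - s\<bar> \<le> l"
  shows "spike e t \<le> profile e s * (1 + l * spike e t)"
proof (cases "\<bar>t\<bar> \<le> 1")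
  case False
  then show ?thesis using profile_bounds(1)[OF assms(1), of s] by (auto simp: spike_def indicator_def)
next
  case True
  \<comment> \<open>Beyond the cut-off the left side is below 1, and the summand 1 of
    \<open>profile\<close> takes over.\<close>
  have p: "1 / (e + \<bar>s\<bar>) \<le> profile e s"
  proof (cases "\<bar>s\<bar> \<le> 1")
    case True
    then have "spike e s = 1 / (e + \<bar>s\<bar>)" by (auto simp: spike_def indicator_def)
    then show ?thesis using spike_bounds(1)[OF assms(1), of "1 - s"] by (simp add: profile_def)
  next
    case False
    then have "1 / (e + \<bar>s\<bar>) \<le> 1" using assms by (auto simp: divide_simps)
    then show ?thesis using profile_bounds[OF assms(1), of s] by linarith
  qed
  have st: "spike e t = 1 / (e + \<bar>t\<bar>)" using True by (auto simp: spike_def indicator_def)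
  have "e + \<bar>s\<bar> \<le> e + \<bar>t\<bar> + l" using assms by linarith
  then have "(e + \<bar>s\<bar>) / (e + \<bar>t\<bar>) \<le> (e + \<bar>t\<bar> + l) / (e + \<bar>t\<bar>)"
    using assms by (intro divide_right_mono) auto
  also have "\<dots> = 1 + l * spike e t" using assms by (auto simp: st field_simps)
  finally have q: "(e + \<bar>s\<bar>) / (e + \<bar>t\<bar>) \<le> 1 + l * spike e t" .
  have "spike e t = 1 / (e + \<bar>s\<bar>) * ((e + \<bar>s\<bar>) / (e + \<bar>t\<bar>))" using assms by (auto simp: st)
  also have "\<dots> \<le> profile e s * (1 + l * spike e t)"
    using assms p q profile_bounds[OF assms(1), of s] by (intro mult_mono) auto
  finally show ?thesis .
qed

lemma profile_reflect: "profile e (1 - t) = profile e t"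
  by (simp add: profile_def)

text \<open>Each of the three summands of \<open>profile e t\<close> contributes one
  \<open>profile e s\<close> to the constant 3; the second spike is handled by reflection.\<close>

lemma profile_le_profile:
  assumes "0 < e" "\<bar>t - s\<bar> \<le> l"
  shows "profile e t \<le> profile e s * (3 + l * (spike e t + spike e (1 - t)))"
proof -
  have "spike e (1 - t) \<le> profile e s * (1 + l * spike e (1 - t))"
    using spike_le_profile[OF assms(1), of "1 - t" "1 - s" l] assms(2) by (simp add: profile_reflect)
  then show ?thesis
    using spike_le_profile[OF assms] profile_bounds[OF assms(1), of s]
    by (simp add: profile_def[of e t] algebra_simps)
qed

text \<open>The one-dimensional A_1 condition in pointwise form, uniform in the interval. In the
  error term the spikes are integrated over the whole line, which costs at most
  \<open>4 * \<Lambda>\<close> whatever the position and length of the interval.\<close>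

lemma nn_integral_profile_le:
  assumes "0 < e" "0 < l" "s \<in> {c..c + l}"
  shows "(\<integral>\<^sup>+t\<in>{c..c + l}. ennreal (profile e t) \<partial>lborel)
    \<le> ennreal (profile e s * l * (3 + 4 * ln ((e + 1) / e)))"
proof -
  define \<Lambda> where "\<Lambda> = ln ((e + 1) / e)"
  have \<Lambda>: "0 \<le> \<Lambda>" using assms by (simp add: \<Lambda>_def)
  have h: "0 \<le> profile e s" using profile_bounds(1)[OF assms(1), of s] by simp
  have sp: "0 \<le> spike e t" for t using spike_bounds[OF assms(1)] by simp
  have "(\<integral>\<^sup>+t\<in>{c..c + l}. ennreal (profile e t) \<partial>lborel)
    \<le> (\<integral>\<^sup>+t. ennreal (profile e s) * (3 * indicator {c..c + l} t + ennreal l * (ennreal (spike e t) + ennreal (spike e (1 - t)))) \<partial>lborel)"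
  proof (intro nn_integral_mono)
    fix t
    show "ennreal (profile e t) * indicator {c..c + l} t \<le>
      ennreal (profile e s) * (3 * indicator {c..c + l} t + ennreal l * (ennreal (spike e t) + ennreal (spike e (1 - t))))"
    proof (cases "t \<in> {c..c + l}")
      case True
      then have "\<bar>t - s\<bar> \<le> l" using assms by auto
      then have "ennreal (profile e t) \<le> ennreal (profile e s * (3 + l * (spike e t + spike e (1 - t))))"
        by (intro ennreal_leI profile_le_profile assms)
      also have "\<dots> = ennreal (profile e s) * (3 + ennreal l * (ennreal (spike e t) + ennreal (spike e (1 - t))))"
        using sp h assms by (simp add: ennreal_mult ennreal_plus)
      finally show ?thesis using True by simp
    qed simp
  qed
  also have "\<dots> = ennreal (profile e s) * (3 * ennreal l +
      ennreal l * ((\<integral>\<^sup>+t. ennreal (spike e t) \<partial>lborel) + (\<integral>\<^sup>+t. ennreal (spike e (1 - t)) \<partial>lborel)))"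
    using assms by (simp add: nn_integral_cmult nn_integral_add)
  also have "\<dots> \<le> ennreal (profile e s) * (3 * ennreal l + ennreal l * (ennreal (2 * \<Lambda>) + ennreal (2 * \<Lambda>)))"
    using nn_integral_spike_le[OF assms(1)] nn_integral_spike_reflect_le[OF assms(1)]
    unfolding \<Lambda>_def by (intro mult_left_mono add_mono) auto
  also have "ennreal (2 * \<Lambda>) + ennreal (2 * \<Lambda>) = ennreal (4 * \<Lambda>)"
    using \<Lambda> by (subst ennreal_plus[symmetric]) auto
  also have "ennreal (profile e s) * (3 * ennreal l + ennreal l * ennreal (4 * \<Lambda>)) =
      ennreal (profile e s * (3 * l + l * (4 * \<Lambda>)))"
    using h \<Lambda> assms by (simp add: ennreal_mult ennreal_plus)
  finally show ?thesis by (simp add: \<Lambda>_def algebra_simps)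
qed

section \<open>The weight and its A_1 constant\<close>

lemma borel_measurable_profile_component:
  "(\<lambda>x :: real ^ 'n::finite. profile e (x $ i)) \<in> borel_measurable borel"
  by (rule measurable_compose[OF _ borel_measurable_profile]) simp

lemma borel_measurable_inverse_profile_component:
  "(\<lambda>x :: real ^ 'n::finite. inverse (ennreal (profile e (x $ i)))) \<in> borel_measurable (lebesgue_on S)"
  by (intro measurable_restrict_space1 measurable_completion)
    (use borel_measurable_profile_component in measurable)

lemma weight_profile:
  assumes "0 < e"
  shows "weight (\<lambda>x :: real ^ 'n::finite. profile e (x $ i))"
  unfolding weight_def
proof (intro conjI allI impI)
  show "0 \<le> profile e (x $ i)" for x :: "real ^ 'n"
    using profile_bounds(1)[OF assms, of "x $ i"] by simp
  fix K :: "(real ^ 'n) set" assume "compact K"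
  then have K: "K \<in> lmeasurable" by (rule lmeasurable_compact)
  show "(\<lambda>x. profile e (x $ i)) absolutely_integrable_on K"
  proof (rule measurable_bounded_by_integrable_imp_absolutely_integrable)
    show "(\<lambda>x. profile e (x $ i)) \<in> borel_measurable (lebesgue_on K)"
      by (intro measurable_restrict_space1 measurable_completion)
        (use borel_measurable_profile_component in simp)
    show "K \<in> sets lebesgue" using K by auto
    show "(\<lambda>_. 1 + 2 / e) integrable_on K" using K by (rule integrable_on_const)
    show "norm (profile e (x $ i)) \<le> 1 + 2 / e" for x :: "real ^ 'n"
      using profile_bounds[OF assms, of "x $ i"] by simp
  qed
qed

text \<open>The average over a cube is at most \<open>K\<close> times the weight at every point of
  the cube, so the reciprocal of the weight is bounded by \<open>K\<close> over the average.\<close>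

lemma A1_const_profile_le:
  assumes "0 < e"
  shows "A1_const (\<lambda>x :: real ^ 'n::finite. profile e (x $ i)) \<le> ennreal (3 + 4 * ln ((e + 1) / e))"
  unfolding A1_const_def
proof (rule SUP_least, clarify)
  fix a :: "real ^ 'n" and l :: real
  assume l: "0 < l"
  define K where "K = 3 + 4 * ln ((e + 1) / e)"
  define avg where "avg = (\<integral>\<^sup>+x\<in>cube a l. ennreal (profile e (x $ i)) \<partial>lebesgue) / emeasure lebesgue (cube a l)"
  have K: "0 < K" using assms by (simp add: K_def add_pos_nonneg)
  have avg_le: "avg \<le> ennreal (K * profile e (x $ i))" if "x \<in> cube a l" for x
  proof -
    have "x $ i \<in> {a $ i..a $ i + l}" using that by (auto simp: cube_def mem_box_cart)
    then have "(\<integral>\<^sup>+x\<in>cube a l. ennreal (profile e (x $ i)) \<partial>lebesgue) \<le>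
      ennreal l ^ (CARD('n) - 1) * ennreal (profile e (x $ i) * l * K)"
      unfolding K_def using assms l
      by (subst nn_integral_cube) (auto intro!: mult_left_mono nn_integral_profile_le)
    also have "\<dots> = ennreal (K * profile e (x $ i)) * emeasure lebesgue (cube a l)"
    proof -
      have "ennreal l ^ CARD('n) = ennreal l ^ (CARD('n) - 1) * ennreal l"
        by (simp add: mult.commute flip: power_Suc)
      then show ?thesis
        using l K profile_bounds(1)[OF assms, of "x $ i"]
        by (simp add: emeasure_cube ennreal_mult mult_ac)
    qed
    finally show ?thesis
      unfolding avg_def using l by (intro divide_le_posI_ennreal) (auto simp: emeasure_cube ennreal_power mult.commute)
  qed
  \<comment> \<open>The bound at the corner shows that the average is finite. The value 0 is split
    off below because \<open>A\<close> becomes a denominator.\<close>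
  have "a \<in> cube a l" using l by (simp add: cube_def mem_box_cart)
  from avg_le[OF this] obtain A where A: "avg = ennreal A" "0 \<le> A"
    by (cases avg) (auto simp: top_unique)
  have "avg * esssup (lebesgue_on (cube a l)) (\<lambda>x. inverse (ennreal (profile e (x $ i)))) \<le> ennreal K"
  proof (cases "A = 0")
    case False
    with A have "0 < A" by simp
    have "esssup (lebesgue_on (cube a l)) (\<lambda>x. inverse (ennreal (profile e (x $ i)))) \<le> ennreal (K / A)"
    proof (intro esssup_I borel_measurable_inverse_profile_component AE_I2)
      fix x assume "x \<in> space (lebesgue_on (cube a l))"
      then have "x \<in> cube a l" by (simp add: cube_def)
      from avg_le[OF this] have "A \<le> K * profile e (x $ i)"
        using A K profile_bounds(1)[OF assms, of "x $ i"] by (simp add: ennreal_le_iff)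
      then show "inverse (ennreal (profile e (x $ i))) \<le> ennreal (K / A)"
        using \<open>0 < A\<close> profile_bounds(1)[OF assms, of "x $ i"]
        by (subst inverse_ennreal) (auto simp: field_simps intro!: ennreal_leI)
    qed
    then have "avg * esssup (lebesgue_on (cube a l)) (\<lambda>x. inverse (ennreal (profile e (x $ i)))) \<le> ennreal A * ennreal (K / A)"
      unfolding A(1) by (rule mult_left_mono) simp
    also have "\<dots> = ennreal K"
      using \<open>0 < A\<close> K by (simp flip: ennreal_mult)
    finally show ?thesis .
  qed (simp add: A)
  then show "(\<integral>\<^sup>+x\<in>cube a l. ennreal (profile e (x $ i)) \<partial>lebesgue) / emeasure lebesgue (cube a l) *
    esssup (lebesgue_on (cube a l)) (\<lambda>x. inverse (ennreal (profile e (x $ i)))) \<le> ennreal (3 + 4 * ln ((e + 1) / e))"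
    by (simp only: avg_def K_def)
qed

text \<open>On a cube away from both spikes the weight is identically 1. This lower bound later
  permits raising the exponent of the A_1 constant.\<close>

lemma A1_const_profile_ge:
  "1 \<le> A1_const (\<lambda>x :: real ^ 'n::finite. profile e (x $ i))"
proof -
  let ?Q = "cube (vec 3) 1 :: (real ^ 'n) set"
  have flat: "profile e (x $ i) = 1" if "x \<in> ?Q" for x
    using that by (auto simp: cube_def mem_box_cart profile_def spike_def indicator_def dest!: spec[of _ i])
  have em: "emeasure lebesgue ?Q = 1" by (simp add: emeasure_cube)
  have "(\<integral>\<^sup>+x\<in>?Q. ennreal (profile e (x $ i)) \<partial>lebesgue) = (\<integral>\<^sup>+x. indicator ?Q x \<partial>lebesgue)"
    by (intro nn_integral_cong) (auto simp: indicator_def flat)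
  also have "\<dots> = 1" by (subst nn_integral_indicator) (simp_all only: em, simp add: cube_def)
  finally have "(\<integral>\<^sup>+x\<in>?Q. ennreal (profile e (x $ i)) \<partial>lebesgue) / emeasure lebesgue ?Q = 1"
    by (simp add: em)
  moreover have "esssup (lebesgue_on ?Q) (\<lambda>x. inverse (ennreal (profile e (x $ i)))) =
      esssup (lebesgue_on ?Q) (\<lambda>x. 1)"
    by (intro esssup_AE_cong borel_measurable_inverse_profile_component) (auto simp: flat cube_def)
  moreover have "\<dots> = 1"
    using em by (intro esssup_const) (auto simp: cube_def emeasure_restrict_space simp del: emeasure_lborel_cbox)
  ultimately show ?thesis
    unfolding A1_const_def by (intro SUP_upper2[of "(vec 3, 1)"]) auto
qed

section \<open>The test function and the cancellation of the peaks\<close>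

lemma GDERIV_cos_component:
  fixes x :: "real ^ 'n::finite"
  shows "GDERIV (\<lambda>x. cos (pi * x $ i)) x :> (- (pi * sin (pi * x $ i))) *\<^sub>R axis i 1"
proof -
  have "GDERIV (\<lambda>x :: real ^ 'n. x $ i) x :> axis i 1"
    using bounded_linear_imp_has_derivative[OF bounded_linear_vec_nth[of i]]
    by (simp add: gderiv_def inner_axis)
  moreover have "DERIV (\<lambda>t. cos (pi * t)) (x $ i) :> - (pi * sin (pi * x $ i))"
    by (auto intro!: derivative_eq_intros)
  ultimately show ?thesis by (rule GDERIV_DERIV_compose)
qed

lemma gradient_eqI:
  fixes x :: "real ^ 'n::finite"
  assumes "GDERIV f x :> D"
  shows "gradient f x = D"
  unfolding gradient_def
proof (rule the_equality)
  show "GDERIV f x :> D" by (rule assms)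
  fix E assume "GDERIV f x :> E"
  from this[unfolded gderiv_def] assms[unfolded gderiv_def]
  have "(\<lambda>h. inner h E) = (\<lambda>h. inner h D)" by (rule has_derivative_unique)
  then have "\<forall>h. inner h E = inner h D" by (rule fun_cong[THEN allI])
  then show "E = D" by (simp only: vector_eq_ldot)
qed

lemma norm_gradient_cos_component:
  fixes x :: "real ^ 'n::finite"
  shows "norm (gradient (\<lambda>x. cos (pi * x $ i)) x) = pi * \<bar>sin (pi * x $ i)\<bar>"
  by (simp add: gradient_eqI[OF GDERIV_cos_component] abs_mult)

lemma lipschitz_cos_component:
  "pi-lipschitz_on UNIV (\<lambda>x :: real ^ 'n::finite. cos (pi * x $ i))"
proof (rule lipschitz_onI)
  fix x y :: "real ^ 'n"
  have "\<bar>cos (pi * x $ i) - cos (pi * y $ i)\<bar>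
    = 2 * (\<bar>sin ((pi * x $ i + pi * y $ i) / 2)\<bar> * \<bar>sin ((pi * y $ i - pi * x $ i) / 2)\<bar>)"
    by (simp add: cos_diff_cos abs_mult)
  also have "\<dots> \<le> 2 * (1 * \<bar>(pi * y $ i - pi * x $ i) / 2\<bar>)"
    by (intro mult_left_mono mult_mono abs_sin_le_one abs_sin_x_le_abs_x) auto
  also have "\<dots> = pi * \<bar>(x - y) $ i\<bar>"
    by (simp add: abs_mult abs_minus_commute flip: right_diff_distrib)
  also have "\<dots> \<le> pi * norm (x - y)"
    by (intro mult_left_mono component_le_norm_cart) auto
  finally show "dist (cos (pi * x $ i)) (cos (pi * y $ i)) \<le> pi * dist x y"
    by (simp add: dist_norm)
qed simp

text \<open>The sine vanishes linearly at 0, which compensates the peak uniformly in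
  \<open>e\<close>.\<close>

lemma spike_times_sin_le:
  assumes "0 < e"
  shows "spike e t * \<bar>sin (pi * t)\<bar> \<le> pi"
proof -
  have "\<bar>sin (pi * t)\<bar> \<le> pi * \<bar>t\<bar>"
    using abs_sin_x_le_abs_x[of "pi * t"] by (simp add: abs_mult)
  also have "\<dots> \<le> pi * (e + \<bar>t\<bar>)" using assms by simp
  finally have "\<bar>sin (pi * t)\<bar> / (e + \<bar>t\<bar>) \<le> pi"
    using assms by (simp add: divide_simps)
  then show ?thesis by (auto simp: spike_def indicator_def)
qed

lemma profile_times_sin_le:
  assumes "0 < e"
  shows "\<bar>sin (pi * t)\<bar> * profile e t \<le> 1 + 2 * pi"
proof -
  have "\<bar>sin (pi * (1 - t))\<bar> = \<bar>sin (pi * t)\<bar>"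
    by (simp add: right_diff_distrib sin_diff)
  then show ?thesis
    using spike_times_sin_le[OF assms, of t] spike_times_sin_le[OF assms, of "1 - t"] abs_sin_le_one[of "pi * t"]
    by (simp add: profile_def distrib_left mult.commute del: abs_sin_le_one)
qed

section \<open>Mass, oscillation and energy on the unit cube\<close>

lemma mass_unit_cube_le:
  assumes "0 < e"
  shows "wmass (\<lambda>x :: real ^ 'n::finite. profile e (x $ i)) (cube 0 1) \<le> 1 + 4 * ln ((e + 1) / e)"
proof -
  define \<Lambda> where "\<Lambda> = ln ((e + 1) / e)"
  have \<Lambda>: "0 \<le> \<Lambda>" using assms by (simp add: \<Lambda>_def)
  have h: "0 \<le> profile e t" for t using profile_bounds(1)[OF assms, of t] by simp
  have sp: "0 \<le> spike e t" for t using spike_bounds[OF assms] by simp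
  have "(\<integral>\<^sup>+t\<in>{0..1}. ennreal (profile e t) \<partial>lborel) \<le>
      (\<integral>\<^sup>+t. indicator {0..1::real} t + (ennreal (spike e t) + ennreal (spike e (1 - t))) \<partial>lborel)"
    using sp by (intro nn_integral_mono) (auto simp: profile_def indicator_def ennreal_plus add.assoc)
  also have "\<dots> = 1 + ((\<integral>\<^sup>+t. ennreal (spike e t) \<partial>lborel) + (\<integral>\<^sup>+t. ennreal (spike e (1 - t)) \<partial>lborel))"
    by (simp add: nn_integral_add)
  also have "\<dots> \<le> 1 + (ennreal (2 * \<Lambda>) + ennreal (2 * \<Lambda>))"
    using nn_integral_spike_le[OF assms(1)] nn_integral_spike_reflect_le[OF assms(1)]
    unfolding \<Lambda>_def by (intro add_mono) auto
  also have "\<dots> = ennreal (1 + 4 * \<Lambda>)"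
    using \<Lambda> by (simp flip: ennreal_plus ennreal_1)
  finally show ?thesis
    unfolding wmass_def using h \<Lambda>
    by (subst set_lebesgue_integral_unit_cube) (auto simp: \<Lambda>_def intro!: enn2real_leI)
qed

text \<open>The oscillation is large on one of the two slabs next to the faces \<open>t = 0\<close> and \<open>t = 1\<close>,
  whatever the value \<open>m\<close> subtracted.\<close>

lemma oscillation_ge:
  assumes "0 < e" "0 \<le> r"
  shows "(1 / 2) powr r * ln ((e + 1 / 3) / e) \<le>
    (LINT x:cube (0 :: real ^ 'n::finite) 1|lebesgue. \<bar>cos (pi * x $ i) - m\<bar> powr r * profile e (x $ i))"
proof -
  define g where "g t = \<bar>cos (pi * t) - m\<bar> powr r * profile e t" for t
  have [measurable]: "g \<in> borel_measurable borel" unfolding g_def by measurable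
  have h: "0 \<le> profile e t" for t using profile_bounds(1)[OF assms(1), of t] by simp
  have g: "0 \<le> g t" for t using h by (simp add: g_def)
  have "(\<integral>\<^sup>+t\<in>{0..1}. ennreal (g t) \<partial>lborel) \<le> (\<integral>\<^sup>+t\<in>{0..1::real}. ennreal ((1 + \<bar>m\<bar>) powr r * (1 + 2 / e)) \<partial>lborel)"
  proof (intro nn_integral_mono mult_right_mono ennreal_leI)
    fix t
    have "\<bar>cos (pi * t) - m\<bar> \<le> 1 + \<bar>m\<bar>" using abs_cos_le_one[of "pi * t"] by linarith
    then show "g t \<le> (1 + \<bar>m\<bar>) powr r * (1 + 2 / e)"
      unfolding g_def using assms h profile_bounds[OF assms(1)] by (intro mult_mono powr_mono2) auto
  qed simp
  \<comment> \<open>Finiteness matters because \<open>enn2real\<close> sends infinity to 0 and is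
    monotone only below it.\<close>
  also have "\<dots> < \<infinity>" by (simp add: nn_integral_cmult ennreal_mult_less_top)
  finally have fin: "(\<integral>\<^sup>+t\<in>{0..1}. ennreal (g t) \<partial>lborel) < top" by simp
  have cmul: "ennreal ((1 / 2) powr r * ln ((e + 1 / 3) / e)) = ennreal ((1 / 2) powr r) * ennreal (ln ((e + 1 / 3) / e))"
    using assms by (intro ennreal_mult) auto
  have "ennreal ((1 / 2) powr r * ln ((e + 1 / 3) / e)) \<le> (\<integral>\<^sup>+t\<in>{0..1}. ennreal (g t) \<partial>lborel)"
  proof (cases "m \<le> 0")
    case True
    have "ennreal ((1 / 2) powr r * ln ((e + 1 / 3) / e)) =
        (\<integral>\<^sup>+t. ennreal ((1 / 2) powr r) * (ennreal (1 / (e + (t - 0))) * indicator {0..0 + 1 / 3} t) \<partial>lborel)"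
      unfolding cmul using assms by (subst nn_integral_cmult) (simp_all only: nn_integral_inverse_right, auto)
    also have "\<dots> \<le> (\<integral>\<^sup>+t\<in>{0..1}. ennreal (g t) \<partial>lborel)"
    proof (intro nn_integral_mono)
      fix t
      show "ennreal ((1 / 2) powr r) * (ennreal (1 / (e + (t - 0))) * indicator {0..0 + 1 / 3} t) \<le> ennreal (g t) * indicator {0..1} t"
      proof (cases "t \<in> {0..1 / 3}")
        case t: True
        \<comment> \<open>The slabs have width 1/3 because the cosine falls to 1/2 at
          \<open>pi / 3\<close>.\<close>
        have "1 / 2 = cos (pi / 3)" by (simp add: cos_60)
        also have "\<dots> \<le> cos (pi * t)" using t by (subst cos_mono_le_eq) (auto simp: field_simps)
        finally have "1 / 2 \<le> \<bar>cos (pi * t) - m\<bar>" using True by simp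
        moreover have "1 / (e + t) \<le> profile e t"
          using t spike_bounds[OF assms(1), of "1 - t"] by (auto simp: profile_def spike_def)
        ultimately have "(1 / 2) powr r * (1 / (e + t)) \<le> g t"
          unfolding g_def using assms t by (intro mult_mono powr_mono2) auto
        then show ?thesis using t assms by (auto simp: ennreal_leI simp flip: ennreal_mult)
      qed simp
    qed
    finally show ?thesis .
  next
    case False
    have "ennreal ((1 / 2) powr r * ln ((e + 1 / 3) / e)) =
        (\<integral>\<^sup>+t. ennreal ((1 / 2) powr r) * (ennreal (1 / (e + (1 - t))) * indicator {1 - 1 / 3..1} t) \<partial>lborel)"
      unfolding cmul using assms by (subst nn_integral_cmult) (simp_all only: nn_integral_inverse_left, auto)
    also have "\<dots> \<le> (\<integral>\<^sup>+t\<in>{0..1}. ennreal (g t) \<partial>lborel)"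
    proof (intro nn_integral_mono)
      fix t
      show "ennreal ((1 / 2) powr r) * (ennreal (1 / (e + (1 - t))) * indicator {1 - 1 / 3..1} t) \<le> ennreal (g t) * indicator {0..1} t"
      proof (cases "t \<in> {1 - 1 / 3..1}")
        case t: True
        have "cos (pi * t) \<le> cos (pi - pi / 3)" using t by (subst cos_mono_le_eq) (auto simp: field_simps)
        also have "\<dots> = - (1 / 2)" unfolding cos_pi_minus by (simp add: cos_60)
        finally have "1 / 2 \<le> \<bar>cos (pi * t) - m\<bar>" using False by simp
        moreover have "1 / (e + (1 - t)) \<le> profile e t"
          using t spike_bounds[OF assms(1), of t] by (auto simp: profile_def spike_def)
        ultimately have "(1 / 2) powr r * (1 / (e + (1 - t))) \<le> g t"
          unfolding g_def using assms t by (intro mult_mono powr_mono2) auto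
        then show ?thesis using t assms by (auto simp: ennreal_leI simp flip: ennreal_mult)
      qed simp
    qed
    finally show ?thesis .
  qed
  then have "enn2real (ennreal ((1 / 2) powr r * ln ((e + 1 / 3) / e))) \<le> enn2real (\<integral>\<^sup>+t\<in>{0..1}. ennreal (g t) \<partial>lborel)"
    using fin by (intro enn2real_mono)
  moreover have "(LINT x:cube (0 :: real ^ 'n) 1|lebesgue. g (x $ i)) = enn2real (\<integral>\<^sup>+t\<in>{0..1}. ennreal (g t) \<partial>lborel)"
    using g by (intro set_lebesgue_integral_unit_cube) auto
  ultimately show ?thesis using assms by (simp add: g_def)
qed

text \<open>Since \<open>p\<close> is at least 1 and the sine is at most 1 in absolute value, its
  \<open>p\<close>-th power is at most its first power, and one power already cancels the
  peaks.\<close>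

lemma gradient_energy_le:
  assumes "0 < e" "1 \<le> p"
  shows "(LINT x:cube (0 :: real ^ 'n::finite) 1|lebesgue.
      norm (gradient (\<lambda>x. cos (pi * x $ i)) x) powr p * profile e (x $ i)) \<le> pi powr p * (1 + 2 * pi)"
proof -
  define g where "g t = (pi * \<bar>sin (pi * t)\<bar>) powr p * profile e t" for t
  have [measurable]: "g \<in> borel_measurable borel" unfolding g_def by measurable
  have h: "0 \<le> profile e t" for t using profile_bounds(1)[OF assms(1), of t] by simp
  have g0: "0 \<le> g t" for t using h by (simp add: g_def)
  have g: "g t \<le> pi powr p * (1 + 2 * pi)" for t
  proof -
    have "\<bar>sin (pi * t)\<bar> powr p \<le> \<bar>sin (pi * t)\<bar>"
      using powr_mono'[of 1 p "\<bar>sin (pi * t)\<bar>"] assms abs_sin_le_one[of "pi * t"] by simp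
    then have "g t \<le> pi powr p * (\<bar>sin (pi * t)\<bar> * profile e t)"
      using h by (simp add: g_def powr_mult mult.assoc mult_right_mono)
    also have "\<dots> \<le> pi powr p * (1 + 2 * pi)"
      by (intro mult_left_mono profile_times_sin_le assms) auto
    finally show ?thesis .
  qed
  have "(\<integral>\<^sup>+t\<in>{0..1}. ennreal (g t) \<partial>lborel) \<le> (\<integral>\<^sup>+t\<in>{0..1::real}. ennreal (pi powr p * (1 + 2 * pi)) \<partial>lborel)"
    by (intro nn_integral_mono mult_right_mono ennreal_leI g) auto
  also have "\<dots> = ennreal (pi powr p * (1 + 2 * pi))" by (simp add: nn_integral_cmult)
  finally have "(LINT x:cube (0 :: real ^ 'n) 1|lebesgue. g (x $ i)) \<le> pi powr p * (1 + 2 * pi)"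
    using g0 by (subst set_lebesgue_integral_unit_cube) (auto intro!: enn2real_leI)
  then show ?thesis by (simp add: norm_gradient_cos_component g_def)
qed

text \<open>The mass is the oscillation integral with exponent 0.\<close>

lemma mass_unit_cube_ge:
  assumes "0 < e"
  shows "ln ((e + 1 / 3) / e) \<le> wmass (\<lambda>x :: real ^ 'n::finite. profile e (x $ i)) (cube 0 1)"
proof -
  \<comment> \<open>The value 2 keeps the base away from 0, because \<open>0 powr 0\<close> is 0
    here.\<close>
  have "\<bar>cos (pi * t) - 2\<bar> powr 0 = 1" for t :: real
    using cos_le_one[of "pi * t"] by (simp del: cos_le_one)
  then show ?thesis
    using oscillation_ge[OF assms, of 0 i 2] by (simp add: wmass_def)
qed

section \<open>Comparison of both sides for large logarithmic parameter\<close>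

theorem proposition7p3:
  fixes p ps \<beta> :: real
  assumes "2 \<le> CARD('n::finite)"
    and "1 \<le> p" and "p < real CARD('n)"
    and "1 / p - 1 / ps = 1 / real CARD('n)"
    and "\<exists>C::real. \<forall>(w :: real ^ 'n \<Rightarrow> real) (f :: real ^ 'n \<Rightarrow> real) (a :: real ^ 'n) (l :: real).
      A1 w \<longrightarrow> (\<exists>L. L-lipschitz_on UNIV f) \<longrightarrow> 0 < l \<longrightarrow>
      wavg w (cube a l) (\<lambda>x. \<bar>f x - wavg w (cube a l) f\<bar> powr ps) powr (1 / ps)
        \<le> C * enn2real (A1_const w) powr \<beta> * l *
          wavg w (cube a l) (\<lambda>x. norm (gradient f x) powr p) powr (1 / p)"
  shows "\<beta> \<ge> 1 / p"
proof (rule ccontr)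
  assume "\<not> \<beta> \<ge> 1 / p"
  from assms(5) obtain C where C: "\<And>(w :: real ^ 'n \<Rightarrow> real) f a l. \<lbrakk>A1 w; \<exists>L. L-lipschitz_on UNIV f; 0 < l\<rbrakk> \<Longrightarrow>
      wavg w (cube a l) (\<lambda>x. \<bar>f x - wavg w (cube a l) f\<bar> powr ps) powr (1 / ps)
        \<le> C * enn2real (A1_const w) powr \<beta> * l *
          wavg w (cube a l) (\<lambda>x. norm (gradient f x) powr p) powr (1 / p)"
    by blast
  have "1 / real CARD('n) < 1 / p" using assms by (intro divide_strict_left_mono) auto
  then have "0 < 1 / ps" using assms(4) by linarith
  then have ps: "0 < ps" by (simp add: zero_less_divide_iff)
  \<comment> \<open>A nonnegative exponent lets the upper bound on the A_1 constant be used also for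
    negative \<open>\<beta>\<close>; it still lies below \<open>1 / p\<close>.\<close>
  define \<gamma> where "\<gamma> = max \<beta> 0"
  have \<gamma>: "0 \<le> \<gamma>" "\<beta> \<le> \<gamma>" "\<gamma> < 1 / p" using \<open>\<not> \<beta> \<ge> 1 / p\<close> assms(2) by (auto simp: \<gamma>_def)
  define M where "M = pi powr p * (1 + 2 * pi)"
  have M: "0 < M" by (simp add: M_def add_pos_pos)
  \<comment> \<open>The 10 is the ratio of the mass bound \<open>5 * \<Lambda>\<close> to the slab
    bound \<open>\<Lambda> / 2\<close>. In \<open>D\<close>, the factors \<open>7\<close> and
    \<open>2 * M\<close> come from the bounds \<open>7 * \<Lambda>\<close> on the A_1 constant and
    \<open>2 * M / \<Lambda>\<close> on the averaged energy.\<close>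
  define c where "c = ((1 / 2) powr ps / 10) powr (1 / ps)"
  define D where "D = \<bar>C\<bar> * 7 powr \<gamma> * (2 * M) powr (1 / p)"
  have bound: "c \<le> D * \<Lambda> powr (\<gamma> - 1 / p)" if \<Lambda>: "4 \<le> \<Lambda>" for \<Lambda>
  proof -
    define i :: 'n where "i = undefined"
    \<comment> \<open>This solves \<open>(e + 1) / e = exp \<Lambda>\<close>, so that
      \<open>\<Lambda>\<close> becomes the free parameter.\<close>
    define e where "e = 1 / (exp \<Lambda> - 1)"
    define w where "w = (\<lambda>x :: real ^ 'n. profile e (x $ i))"
    define f where "f = (\<lambda>x :: real ^ 'n. cos (pi * x $ i))"
    define Q where "Q = cube (0 :: real ^ 'n) 1"
    define W where "W = wmass w Q"
    have "1 < exp \<Lambda>" using \<Lambda> by simp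
    then have e: "0 < e" by (simp add: e_def)
    have ratio: "(e + 1) / e = exp \<Lambda>" using \<open>1 < exp \<Lambda>\<close> by (simp add: e_def field_simps)
    have l1: "ln ((e + 1) / e) = \<Lambda>" by (simp add: ratio)
    have "exp \<Lambda> / 3 \<le> (e + 1 / 3) / e" unfolding ratio[symmetric] using e by (simp add: field_simps)
    then have "ln (exp \<Lambda> / 3) \<le> ln ((e + 1 / 3) / e)" using e by (subst ln_le_cancel_iff) auto
    \<comment> \<open>The loss \<open>ln 3\<close> is at most 2, hence at most
      \<open>\<Lambda> / 2\<close> once \<open>\<Lambda>\<close> is at least 4.\<close>
    moreover have "ln (3::real) \<le> 2" using ln_le_minus_one[of 3] by simp
    ultimately have l2: "\<Lambda> / 2 \<le> ln ((e + 1 / 3) / e)" using \<Lambda> by (simp add: ln_div)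
    have W: "\<Lambda> / 2 \<le> W" "W \<le> 5 * \<Lambda>"
      using mass_unit_cube_ge[OF e, of i] mass_unit_cube_le[OF e, of i] l1 l2 \<Lambda>
      by (auto simp: W_def w_def Q_def)
    have up: "A1_const w \<le> ennreal (3 + 4 * \<Lambda>)"
      using A1_const_profile_le[OF e, of i] by (simp add: w_def l1)
    have "A1 w" unfolding A1_def
      using up weight_profile[OF e, of i] by (auto simp: w_def intro: le_less_trans)
    then have main: "wavg w Q (\<lambda>x. \<bar>f x - wavg w Q f\<bar> powr ps) powr (1 / ps)
        \<le> C * enn2real (A1_const w) powr \<beta> * 1 * wavg w Q (\<lambda>x. norm (gradient f x) powr p) powr (1 / p)"
      unfolding Q_def using lipschitz_cos_component[of i] by (intro C) (auto simp: f_def)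
    have A: "1 \<le> enn2real (A1_const w)" "enn2real (A1_const w) \<le> 7 * \<Lambda>"
    proof -
      have "A1_const w < top" using up by (auto intro: le_less_trans)
      from enn2real_mono[OF A1_const_profile_ge this[unfolded w_def]]
      show "1 \<le> enn2real (A1_const w)" by (simp add: w_def)
      show "enn2real (A1_const w) \<le> 7 * \<Lambda>"
        using enn2real_leI[OF _ up] \<Lambda> by simp
    qed
    have "(1 / 2) powr ps / 10 = (1 / 2) powr ps * (\<Lambda> / 2) / (5 * \<Lambda>)" using \<Lambda> by simp
    also have "\<dots> \<le> ((1 / 2) powr ps * ln ((e + 1 / 3) / e)) / W"
      using W l2 \<Lambda> by (intro frac_le mult_left_mono) auto
    also have "\<dots> \<le> wavg w Q (\<lambda>x. \<bar>f x - wavg w Q f\<bar> powr ps)"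
      using oscillation_ge[OF e, of ps i "wavg w Q f"] ps W \<Lambda>
      by (auto simp: wavg_def[of w Q "\<lambda>x. \<bar>f x - wavg w Q f\<bar> powr ps"] W_def[symmetric] f_def[symmetric] divide_right_mono
           simp del: powr_divide)
         (simp add: f_def w_def Q_def divide_right_mono)
    finally have "c \<le> wavg w Q (\<lambda>x. \<bar>f x - wavg w Q f\<bar> powr ps) powr (1 / ps)"
      unfolding c_def using ps by (intro powr_mono2) auto
    also note main
    also have "C * enn2real (A1_const w) powr \<beta> * 1 * wavg w Q (\<lambda>x. norm (gradient f x) powr p) powr (1 / p)
       \<le> \<bar>C\<bar> * (7 * \<Lambda>) powr \<gamma> * 1 * (2 * M / \<Lambda>) powr (1 / p)"
    proof (intro mult_mono)
      \<comment> \<open>Raising the exponent needs a base of at least 1; raising the base needs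
        \<open>\<gamma>\<close> nonnegative.\<close>
      have "enn2real (A1_const w) powr \<beta> \<le> enn2real (A1_const w) powr \<gamma>"
        using A \<gamma> by (intro powr_mono) auto
      also have "\<dots> \<le> (7 * \<Lambda>) powr \<gamma>"
        using A \<gamma> by (intro powr_mono2) auto
      finally show "enn2real (A1_const w) powr \<beta> \<le> (7 * \<Lambda>) powr \<gamma>" .
      define G where "G = (LINT x:Q|lebesgue. norm (gradient f x) powr p * w x)"
      have "0 \<le> w x" for x using profile_bounds(1)[OF e, of "x $ i"] by (simp add: w_def)
      then have G0: "0 \<le> G" by (simp add: G_def set_lebesgue_integral_def)
      have "G \<le> M" using gradient_energy_le[OF e assms(2), of i] by (simp add: G_def f_def w_def Q_def M_def)
      \<comment> \<open>Bounded energy against mass of order \<open>\<Lambda>\<close>: this is the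
        source of the exponent \<open>- 1 / p\<close>.\<close>
      then have "G / W \<le> M / (\<Lambda> / 2)" using G0 W \<Lambda> by (intro frac_le) auto
      then show "wavg w Q (\<lambda>x. norm (gradient f x) powr p) powr (1 / p) \<le> (2 * M / \<Lambda>) powr (1 / p)"
        using G0 W \<Lambda> assms(2) by (intro powr_mono2) (auto simp: wavg_def G_def W_def mult.commute)
    qed auto
    also have "\<dots> = D * \<Lambda> powr (\<gamma> - 1 / p)"
      using \<Lambda> M by (simp add: D_def powr_mult powr_divide powr_diff)
    finally show ?thesis .
  qed
  \<comment> \<open>The exponent is negative, so the right side tends to 0 while \<open>c\<close> is
    a fixed positive number.\<close>
  have "((\<lambda>\<Lambda>. D * \<Lambda> powr (\<gamma> - 1 / p)) \<longlongrightarrow> D * 0) at_top"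
    using \<gamma> by (intro tendsto_mult_left tendsto_neg_powr filterlim_ident) auto
  then have "c \<le> D * 0"
    by (rule tendsto_lowerbound) (auto intro!: eventually_at_top_linorderI[of 4] bound)
  moreover have "0 < c" by (simp add: c_def)
  ultimately show False by simp
qed

end
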